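(* Let $k,m,n$ be integers with $1\le k\le2$ and $k\le m\le n$. Then every zero of the antichain polynomial $\mathcal N_{[k]\times[m]\times[n]}(x)$ is simple and negative (in particular, real).
   Context: For a positive integer $k$, $[k]=\{1<\cdots<k\}$ is the $k$-element chain; products carry the componentwise order. The antichain polynomial of a finite poset $Q$ is $\mathcal N_Q(x)=\sum_{\mathcal A}x^{|\mathcal A|}$, the sum over all antichains $\mathcal A$ of $Q$ (sets of pairwise incomparable elements, including the empty set). *)

theory Defs
  imports Complex_Main "HOL-Library.Product_Order" "HOL-Computational_Algebra.Polynomial"
begin

text \<open>
  A finite poset is represented as a finite subset of a type of class \<open>order\<close>, with the induced
  order. The componentwise order on products is the instance of \<open>HOL-Library.Product_Order\<close>.
\<close>

definition antichains :: "'a::order set \<Rightarrow> 'a set set" where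
  "antichains Q = {A. A \<subseteq> Q \<and> (\<forall>x\<in>A. \<forall>y\<in>A. x \<noteq> y \<longrightarrow> \<not> x \<le> y \<and> \<not> y \<le> x)}"

definition antichain_poly :: "'a::order set \<Rightarrow> 'b::comm_semiring_1 poly" where
  "antichain_poly Q = (\<Sum>A\<in>antichains Q. monom 1 (card A))"

definition chain_set :: "nat \<Rightarrow> nat set" where
  "chain_set k = {1..k}"

end

theory Submission
  imports Defs
begin

text \<open>
  Peeling the rows of the poset off one chain at a time gives a recursion that is solved by a
  two-by-two determinant of binomial sums. With
  $T = \sum_j \binom{m}{j} \binom{n}{j} x^j / (j+1)$ the antichain polynomial is $T + x T'$ for
  $k = 1$. For $k = 2$ both off-diagonal entries of the determinant are multiples of $x T'$, so that
  the antichain polynomial is a difference of squares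
  $(T + x T')^2 - c^2 (x T')^2 = (T + (1 + c) x T') (T - (c - 1) x T')$ with
  $c^2 = (m+1)(n+1)/(mn)$. A Rodrigues formula shows that $T$ has $m$ simple negative zeros, Rolle's
  theorem carries this over to the two factors, and a common zero of the factors would be a double
  zero of $T$.
\<close>

section \<open>Peeling a chain off a poset\<close>

text \<open>An antichain meets the chain \<open>C\<close> in at most one element \<open>c\<close>.
  If it does meet it, deleting \<open>c\<close> leaves an arbitrary antichain among the elements
  incomparable to \<open>c\<close>.\<close>

lemma antichain_poly_chain_rec:
  fixes Q C :: "'a::order set"
  assumes fin: "finite Q" and sub: "C \<subseteq> Q"
    and chain: "\<And>x y. x \<in> C \<Longrightarrow> y \<in> C \<Longrightarrow> x \<le> y \<or> y \<le> x"
  shows "(antichain_poly Q :: 'b::comm_semiring_1 poly) = antichain_poly (Q - C) +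
    monom 1 1 * (\<Sum>c\<in>C. antichain_poly {q\<in>Q. \<not> q \<le> c \<and> \<not> c \<le> q})"
proof -
  define I where "I c = {q\<in>Q. \<not> q \<le> c \<and> \<not> c \<le> q}" for c
  have finA: "finite (antichains S)" if "S \<subseteq> Q" for S
    by (rule finite_subset[of _ "Pow S"])
      (use that fin in \<open>auto simp: antichains_def dest: finite_subset\<close>)
  have subI: "I c \<subseteq> Q" for c by (auto simp: I_def)
  have finC: "finite C" using fin sub finite_subset by blast
  have split: "antichains Q = antichains (Q - C) \<union> (\<Union>c\<in>C. insert c ` antichains (I c))"
  proof (intro equalityI subsetI)
    fix A assume A: "A \<in> antichains Q"
    show "A \<in> antichains (Q - C) \<union> (\<Union>c\<in>C. insert c ` antichains (I c))"
    proof (cases "A \<inter> C = {}")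
      case True
      then show ?thesis using A by (auto simp: antichains_def)
    next
      case False
      then obtain c where c: "c \<in> A" "c \<in> C" by auto
      have "A - {c} \<in> antichains (I c)"
        using A c by (fastforce simp: antichains_def I_def)
      moreover have "A = insert c (A - {c})" using c by auto
      ultimately show ?thesis using c by blast
    qed
  next
    fix A assume "A \<in> antichains (Q - C) \<union> (\<Union>c\<in>C. insert c ` antichains (I c))"
    then show "A \<in> antichains Q"
      using sub by (fastforce simp: antichains_def I_def)
  qed
  have disj1: "antichains (Q - C) \<inter> (\<Union>c\<in>C. insert c ` antichains (I c)) = {}"
    by (auto simp: antichains_def)
  have notin: "x \<notin> A" if "A \<in> antichains (I c)" "x \<in> C" "c \<in> C" for A c x
    using that chain by (auto simp: antichains_def I_def)
  have "(antichain_poly Q :: 'b poly) = antichain_poly (Q - C) +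
      (\<Sum>A\<in>(\<Union>c\<in>C. insert c ` antichains (I c)). monom 1 (card A))"
    unfolding antichain_poly_def split
    by (rule sum.union_disjoint) (use disj1 finA finC subI in auto)
  also have "(\<Sum>A\<in>(\<Union>c\<in>C. insert c ` antichains (I c)). monom (1::'b) (card A)) =
      (\<Sum>c\<in>C. \<Sum>A\<in>insert c ` antichains (I c). monom 1 (card A))"
  proof (rule sum.UNION_disjoint)
    show "\<forall>c\<in>C. \<forall>d\<in>C. c \<noteq> d \<longrightarrow>
        insert c ` antichains (I c) \<inter> insert d ` antichains (I d) = {}"
      using notin by blast
  qed (use finA finC subI in auto)
  also have "\<dots> = (\<Sum>c\<in>C. \<Sum>A\<in>antichains (I c). monom 1 1 * monom 1 (card A))"
  proof (rule sum.cong[OF refl])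
    fix c assume c: "c \<in> C"
    have "inj_on (insert c) (antichains (I c))"
      using notin[OF _ c c] by (meson inj_onI insert_ident)
    moreover have "card (insert c A) = Suc (card A)" if "A \<in> antichains (I c)" for A
    proof -
      have "finite A" using that subI[of c] fin
        by (auto simp: antichains_def intro: finite_subset)
      then show ?thesis using notin[OF that c c] by simp
    qed
    ultimately show "(\<Sum>A\<in>insert c ` antichains (I c). monom (1::'b) (card A)) =
        (\<Sum>A\<in>antichains (I c). monom 1 1 * monom 1 (card A))"
      by (simp add: sum.reindex mult_monom)
  qed
  finally show ?thesis
    by (simp add: antichain_poly_def sum_distrib_left I_def)
qed

section \<open>Binomial sums and Pascal's rule\<close>

text \<open>The shifts \<open>a\<close> and \<open>b\<close> make the family closed under Pascal's
  rule in \<open>i\<close> and in \<open>u\<close>. Cutting off at \<open>i\<close> loses nothing,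
  since \<open>i choose (j + a)\<close> vanishes for larger \<open>j\<close>.\<close>

definition binom_poly :: "nat \<Rightarrow> nat \<Rightarrow> nat \<Rightarrow> nat \<Rightarrow> 'a::comm_ring_1 poly" where
  "binom_poly i a u b = (\<Sum>j\<le>i. monom (of_nat ((i choose (j + a)) * (u choose (j + b)))) j)"

lemma coeff_binom_poly:
  "coeff (binom_poly i a u b) j = of_nat ((i choose (j + a)) * (u choose (j + b)))"
  by (auto simp: binom_poly_def coeff_sum binomial_eq_0)

lemma coeff_monom_1_1_mult:
  "coeff (monom 1 1 * p :: 'a::comm_ring_1 poly) j = (case j of 0 \<Rightarrow> 0 | Suc i \<Rightarrow> coeff p i)"
  by (cases j) (simp_all add: coeff_monom_mult)

lemma binom_poly_Suc_row:
  "binom_poly (Suc i) (Suc a) u b = binom_poly i (Suc a) u b + binom_poly i a u b"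
  by (rule poly_eqI) (simp add: coeff_binom_poly algebra_simps)

text \<open>Pascal's rule would lower the shift 0 to -1. Reindexing \<open>j\<close> replaces this
  by a factor x and raises the other shift.\<close>

lemma binom_poly_Suc_row_0:
  "binom_poly (Suc i) 0 u b = binom_poly i 0 u b + monom 1 1 * binom_poly i 0 u (Suc b)"
  by (rule poly_eqI)
    (auto simp: coeff_binom_poly coeff_monom_1_1_mult algebra_simps simp del: One_nat_def split: nat.split)

lemma binom_poly_Suc_col:
  "binom_poly i a (Suc u) (Suc b) = binom_poly i a u (Suc b) + binom_poly i a u b"
  by (rule poly_eqI) (simp add: coeff_binom_poly algebra_simps)

lemma binom_poly_Suc_col_0:
  "binom_poly i a (Suc u) 0 = binom_poly i a u 0 + monom 1 1 * binom_poly i (Suc a) u 0"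
  by (rule poly_eqI)
    (auto simp: coeff_binom_poly coeff_monom_1_1_mult algebra_simps simp del: One_nat_def split: nat.split)

lemma binom_poly_eq_0: "i < a \<or> u < b \<Longrightarrow> binom_poly i a u b = 0"
  by (rule poly_eqI) (auto simp: coeff_binom_poly binomial_eq_0)

text \<open>The hockey-stick identity, applied to each coefficient.\<close>

lemma sum_binom_poly: "(\<Sum>d<u. binom_poly i a d b) = binom_poly i a u (Suc b)"
  by (induction u) (simp_all add: binom_poly_eq_0 binom_poly_Suc_col add.commute)

lemma sum_binom_poly_Suc: "(\<Sum>d<u. binom_poly i a (Suc d) (Suc b)) = binom_poly i a (Suc u) (Suc (Suc b))"
  using sum_binom_poly[of i a "Suc b" "Suc u"]
  by (simp add: sum.lessThan_Suc_shift binom_poly_eq_0 del: sum.lessThan_Suc)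

section \<open>Peeling rows off the two-level poset\<close>

text \<open>Level 1 keeps the rows above \<open>r\<close> with \<open>u\<close> columns, level 2 the
  rows above \<open>s\<close> with \<open>v\<close> columns. Two row bounds are needed because the
  levels lose a row alternately; the column bounds shrink when an element is chosen.\<close>

definition region :: "nat \<Rightarrow> nat \<Rightarrow> nat \<Rightarrow> nat \<Rightarrow> nat \<Rightarrow> (nat \<times> nat \<times> nat) set" where
  "region m r u s v = {1} \<times> {r<..m} \<times> {1..u} \<union> {2} \<times> {s<..m} \<times> {1..v}"

lemma finite_region [simp]: "finite (region m r u s v)"
  by (simp add: region_def)

text \<open>Every remaining row is at least \<open>Suc r\<close>, so what is incomparable to
  \<open>(1, Suc r, Suc b)\<close> has column at most \<open>b\<close> on both levels, and on level
  1 also a row beyond \<open>Suc r\<close>. The new bounds again satisfy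
  \<open>min v b \<le> b\<close>.\<close>

lemma antichain_poly_region_level1:
  assumes "r < m" "v \<le> u"
  shows "(antichain_poly (region m r u r v) :: 'b::comm_semiring_1 poly) =
    antichain_poly (region m (Suc r) u r v) +
    monom 1 1 * (\<Sum>b<u. antichain_poly (region m (Suc r) b r (min v b)))"
proof -
  define C where "C = {1::nat} \<times> {Suc r} \<times> {1..u}"
  have C_eq: "C = (\<lambda>b. (1, Suc r, Suc b)) ` {..<u}"
    unfolding C_def image_Suc_lessThan[symmetric] by auto
  have "(antichain_poly (region m r u r v) :: 'b poly) = antichain_poly (region m r u r v - C) +
    monom 1 1 * (\<Sum>c\<in>C. antichain_poly {q\<in>region m r u r v. \<not> q \<le> c \<and> \<not> c \<le> q})"
    by (rule antichain_poly_chain_rec) (use assms in \<open>auto simp: C_def region_def\<close>)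
  also have "region m r u r v - C = region m (Suc r) u r v"
    using assms by (auto simp: C_def region_def)
  also have "(\<Sum>c\<in>C. antichain_poly {q\<in>region m r u r v. \<not> q \<le> c \<and> \<not> c \<le> q}) =
     (\<Sum>b<u. antichain_poly (region m (Suc r) b r (min v b)) :: 'b poly)"
    unfolding C_eq
    by (subst sum.reindex) (auto simp: inj_on_def region_def intro!: sum.cong arg_cong[where f=antichain_poly])
  finally show ?thesis .
qed

text \<open>Once row \<open>Suc r\<close> is gone from level 1, all of level 1 is incomparable to
  row \<open>Suc r\<close> of level 2: its rows are larger but its level is smaller. Only the
  columns of level 2 shrink.\<close>

lemma antichain_poly_region_level2:
  assumes "r < m" "v \<le> u"
  shows "(antichain_poly (region m (Suc r) u r v) :: 'b::comm_semiring_1 poly) =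
    antichain_poly (region m (Suc r) u (Suc r) v) +
    monom 1 1 * (\<Sum>d<v. antichain_poly (region m (Suc r) u (Suc r) d))"
proof -
  define C where "C = {2::nat} \<times> {Suc r} \<times> {1..v}"
  have C_eq: "C = (\<lambda>b. (2, Suc r, Suc b)) ` {..<v}"
    unfolding C_def image_Suc_lessThan[symmetric] by auto
  have "(antichain_poly (region m (Suc r) u r v) :: 'b poly) = antichain_poly (region m (Suc r) u r v - C) +
    monom 1 1 * (\<Sum>c\<in>C. antichain_poly {q\<in>region m (Suc r) u r v. \<not> q \<le> c \<and> \<not> c \<le> q})"
    by (rule antichain_poly_chain_rec) (use assms in \<open>auto simp: C_def region_def\<close>)
  also have "region m (Suc r) u r v - C = region m (Suc r) u (Suc r) v"
    using assms by (auto simp: C_def region_def)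
  also have "(\<Sum>c\<in>C. antichain_poly {q\<in>region m (Suc r) u r v. \<not> q \<le> c \<and> \<not> c \<le> q}) =
     (\<Sum>b<v. antichain_poly (region m (Suc r) u (Suc r) b) :: 'b poly)"
    unfolding C_eq
    by (subst sum.reindex) (use assms in \<open>auto simp: inj_on_def region_def intro!: sum.cong arg_cong[where f=antichain_poly]\<close>)
  finally show ?thesis .
qed

text \<open>The second product counts the pairs of two-rowed arrays obtained by exchanging tails at the
  first violation, as in the Lindstroem--Gessel--Viennot lemma. For \<open>v \<le> u\<close> the truncated
  subtractions are harmless: if \<open>i = 0\<close> the first factor of that product vanishes, and if
  \<open>u = 0\<close> the second one does.\<close>

definition lgv_poly :: "nat \<Rightarrow> nat \<Rightarrow> nat \<Rightarrow> 'a::comm_ring_1 poly" where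
  "lgv_poly i u v = binom_poly i 0 u 0 * binom_poly i 0 v 0 -
     monom 1 1 * binom_poly (Suc i) 2 (u - 1) 0 * (monom 1 1 * binom_poly (i - 1) 0 (Suc v) 2)"

text \<open>Each product is linear in its factor depending on \<open>v\<close>. Summing that factor
  is the hockey-stick identity, and Pascal's rule at shift 0 then raises its row parameter by
  one.\<close>

lemma lgv_level2:
  "lgv_poly i u v + monom 1 1 * (\<Sum>d<v. lgv_poly i u d) =
    (binom_poly i 0 u 0 * binom_poly (Suc i) 0 v 0 -
     monom 1 1 * binom_poly (Suc i) 2 (u - 1) 0 * (monom 1 1 * binom_poly i 0 (Suc v) 2) :: 'a::comm_ring_1 poly)"
    (is "_ = ?r")
proof -
  define X where "X = (monom 1 1 :: 'a poly)"
  define Q where "Q = (X * binom_poly (Suc i) 2 (u - 1) 0 :: 'a poly)"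
  define R where "R d = (X * binom_poly (i - 1) 0 (Suc d) 2 :: 'a poly)" for d
  define P where "P d = (binom_poly i 0 d 0 :: 'a poly)" for d
  have R: "Q * (R v + X * sum R {..<v}) = Q * (X * binom_poly i 0 (Suc v) 2)"
  proof (cases i)
    case 0
    then show ?thesis by (simp add: Q_def binom_poly_eq_0)
  next
    case (Suc k)
    have "(\<Sum>d<v. binom_poly k 0 (Suc d) 2) = (binom_poly k 0 (Suc v) 3 :: 'a poly)"
      using sum_binom_poly_Suc[of k 0 1 v] by (simp add: numeral_2_eq_2 numeral_3_eq_3)
    then have "sum R {..<v} = X * binom_poly k 0 (Suc v) 3"
      by (simp add: R_def Suc flip: sum_distrib_left)
    then show ?thesis
      using binom_poly_Suc_row_0[of k "Suc v" 2, where ?'a='a]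
      by (simp add: R_def Suc X_def[symmetric] numeral_3_eq_3 algebra_simps numeral_2_eq_2
          del: One_nat_def)
  qed
  have sums: "(\<Sum>d<v. P u * P d - Q * R d) = P u * sum P {..<v} - Q * sum R {..<v}"
    by (simp add: sum_subtractf sum_distrib_left)
  have "lgv_poly i u v + X * (\<Sum>d<v. lgv_poly i u d) =
      P u * (P v + X * sum P {..<v}) - Q * (R v + X * sum R {..<v})"
    unfolding lgv_poly_def X_def[symmetric] P_def[symmetric] Q_def[symmetric] R_def[symmetric] sums
    by (simp add: algebra_simps)
  also have "P v + X * sum P {..<v} = binom_poly (Suc i) 0 v 0"
    by (simp add: P_def sum_binom_poly X_def binom_poly_Suc_row_0)
  finally show ?thesis unfolding R by (simp only: P_def Q_def X_def)
qed

text \<open>A telescoping sum: \<open>A\<close> and \<open>B\<close> below have increments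
  \<open>P\<close> and \<open>Q\<close>. For \<open>b \<ge> v\<close> the factors \<open>P'\<close>
  and \<open>R\<close> are frozen at \<open>v\<close>; for \<open>b < v\<close> they vary too, but
  the contributions of their increments cancel.\<close>

lemma lgv_level1:
  assumes "v \<le> u"
  shows "(\<Sum>b<u. binom_poly i 0 b 0 * binom_poly (Suc i) 0 (min v b) 0 -
     monom 1 1 * binom_poly (Suc i) 2 (b - 1) 0 * (monom 1 1 * binom_poly i 0 (Suc (min v b)) 2)) =
    (binom_poly (Suc i) 0 v 0 * binom_poly i 0 u 1 -
      monom 1 1 * binom_poly i 0 (Suc v) 2 * binom_poly (Suc i) 1 (u - 1) 0 :: 'a::comm_ring_1 poly)"
proof -
  define X where "X = (monom 1 1 :: 'a poly)"
  define P where "P b = (binom_poly i 0 b 0 :: 'a poly)" for b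
  define P' where "P' b = (binom_poly (Suc i) 0 b 0 :: 'a poly)" for b
  define Q where "Q b = (X * binom_poly (Suc i) 2 (b - 1) 0 :: 'a poly)" for b
  define R where "R b = (X * binom_poly i 0 (Suc b) 2 :: 'a poly)" for b
  define A where "A b = (binom_poly i 0 b 1 :: 'a poly)" for b
  define B where "B b = (binom_poly (Suc i) 1 (b - 1) 0 :: 'a poly)" for b
  have R0: "R 0 = 0" by (simp add: R_def binom_poly_eq_0)
  have A: "A (Suc b) = A b + P b" for b
    by (simp add: A_def P_def binom_poly_Suc_col)
  have B: "B (Suc b) = B b + Q b" if "b > 0" for b
    using that binom_poly_Suc_col_0[of "Suc i" 1 "b - 1", where ?'a='a]
    by (simp add: B_def Q_def X_def numeral_2_eq_2)
  have P': "P' (Suc b) = P' b + X * B (Suc b)" for b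
    by (simp add: P'_def B_def X_def binom_poly_Suc_col_0)
  have R: "R (Suc b) = R b + X * A (Suc b)" for b
    by (simp add: R_def A_def binom_poly_Suc_col[of i 0 "Suc b"] numeral_2_eq_2 algebra_simps)
  \<comment> \<open>Both sides of the step differ by \<open>(P' (Suc w) - P' w) A - (R (Suc w) - R w) B = X B A - X A B\<close>,
    with \<open>A\<close> and \<open>B\<close> taken at \<open>Suc w\<close>.\<close>
  have diag: "(\<Sum>b<w. P b * P' b - Q b * R b) = P' w * A w - R w * B w" for w
  proof (induction w)
    case 0
    then show ?case by (simp add: R0 A_def binom_poly_eq_0)
  next
    case (Suc w)
    show ?case
    \<comment> \<open>The truncated \<open>b - 1\<close> breaks the recursion of \<open>B\<close> at
      0; there \<open>R 0 = 0\<close> makes it unnecessary.\<close>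
    proof (cases "w = 0")
      case True
      then show ?thesis using P'[of 0] A[of 0] R[of 0]
        by (simp add: R0 A_def binom_poly_eq_0 algebra_simps)
    next
      case False
      then show ?thesis using Suc P'[of w] A[of w] R[of w] B[of w]
        by (simp add: algebra_simps)
    qed
  qed
  have "(\<Sum>b<u. P b * P' (min v b) - Q b * R (min v b)) = P' v * A u - R v * B u"
    using assms
  proof (induction u rule: dec_induct)
    case base
    have "(\<Sum>b<v. P b * P' (min v b) - Q b * R (min v b)) = (\<Sum>b<v. P b * P' b - Q b * R b)"
      by (rule sum.cong) auto
    then show ?case using diag by simp
  next
    case (step w)
    show ?case
    proof (cases "w = 0")
      case True
      then show ?thesis using step A[of 0]
        by (simp add: R0 A_def binom_poly_eq_0 algebra_simps)
    next
      case False
      then show ?thesis using step A[of w] B[of w]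
        by (simp add: algebra_simps)
    qed
  qed
  then show ?thesis by (simp only: P_def P'_def Q_def R_def A_def B_def X_def)
qed

text \<open>Induction on the number \<open>i\<close> of rows left on each level; a step peels one
  row off level 1 and then one off level 2.\<close>

lemma antichain_poly_region:
  assumes "v \<le> u" "r + i = m"
  shows "(antichain_poly (region m r u r v) :: 'a::comm_ring_1 poly) = lgv_poly i u v"
  using assms
proof (induction i arbitrary: r u v)
  case 0
  then have "region m r u r v = {}" by (auto simp: region_def)
  moreover have "antichains {} = {{} :: (nat \<times> nat \<times> nat) set}"
    by (auto simp: antichains_def)
  ultimately have "(antichain_poly (region m r u r v) :: 'a poly) = 1"
    by (simp add: antichain_poly_def monom_0 one_pCons)
  moreover have "(lgv_poly 0 u v :: 'a poly) = 1"
    by (simp add: lgv_poly_def binom_poly_eq_0) (simp add: binom_poly_def monom_0 one_pCons)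
  ultimately show ?case by simp
next
  case (Suc i)
  \<comment> \<open>The state between the two peelings, with \<open>i\<close> rows left on level 1
    and \<open>Suc i\<close> on level 2. It is needed for all \<open>v \<le> u\<close>, as the sum
    over level 1 uses it at \<open>b\<close> and \<open>min v b\<close>.\<close>
  have g: "(antichain_poly (region m (Suc r) u r v) :: 'a poly) =
     binom_poly i 0 u 0 * binom_poly (Suc i) 0 v 0 -
     monom 1 1 * binom_poly (Suc i) 2 (u - 1) 0 * (monom 1 1 * binom_poly i 0 (Suc v) 2)"
    if "v \<le> u" for u v
  proof -
    have "(\<Sum>d<v. antichain_poly (region m (Suc r) u (Suc r) d)) = (\<Sum>d<v. lgv_poly i u d :: 'a poly)"
      using that Suc.prems by (intro sum.cong Suc.IH) auto
    then show ?thesis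
      using that Suc.prems Suc.IH[of v u "Suc r"]
      by (simp add: antichain_poly_region_level2 lgv_level2 del: One_nat_def)
  qed
  have level1: "(\<Sum>b<u. antichain_poly (region m (Suc r) b r (min v b))) =
     (binom_poly (Suc i) 0 v 0 * binom_poly i 0 u 1 -
      monom 1 1 * binom_poly i 0 (Suc v) 2 * binom_poly (Suc i) 1 (u - 1) 0 :: 'a poly)"
    unfolding lgv_level1[OF Suc.prems(1), symmetric]
    by (intro sum.cong refl g) simp
  have "(antichain_poly (region m r u r v) :: 'a poly) = antichain_poly (region m (Suc r) u r v) +
      monom 1 1 * (\<Sum>b<u. antichain_poly (region m (Suc r) b r (min v b)))"
    using Suc.prems by (intro antichain_poly_region_level1) auto
  \<comment> \<open>The terms are grouped so that Pascal's rule applies inside both brackets, with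
    shift 0 in the first and shift 2 in the second.\<close>
  also have "\<dots> = binom_poly (Suc i) 0 v 0 * (binom_poly i 0 u 0 + monom 1 1 * binom_poly i 0 u 1) -
      monom 1 1 * binom_poly i 0 (Suc v) 2 *
        (monom 1 1 * (binom_poly (Suc i) 2 (u - 1) 0 + binom_poly (Suc i) 1 (u - 1) 0))"
    unfolding g[OF Suc.prems(1)] level1 by (simp add: algebra_simps)
  also have "\<dots> = lgv_poly (Suc i) u v"
    using binom_poly_Suc_row[of "Suc i" 1 "u - 1" 0, where ?'a='a]
    by (simp add: lgv_poly_def binom_poly_Suc_row_0[of i u] numeral_2_eq_2 algebra_simps)
  finally show ?case .
qed

section \<open>Counting zeros and Rolle's theorem\<close>

text \<open>A linear factor for a zero outside \<open>Z\<close>, or for a multiple zero, could be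
  divided out and leave a nonzero quotient of smaller degree that still vanishes on all of
  \<open>Z\<close>.\<close>

lemma card_roots_ge_degree_imp_simple:
  fixes p :: "'a::idom poly"
  assumes "p \<noteq> 0" "finite Z" "degree p \<le> card Z"
    and Z: "\<And>z. z \<in> Z \<Longrightarrow> poly p z = 0" and w: "poly p w = 0"
  shows "w \<in> Z \<and> order w p = 1"
proof -
  have bound: "card Z < card Z" if "p = [:-w, 1:] * q" "\<And>z. z \<in> Z \<Longrightarrow> poly q z = 0" for q
  proof -
    have "q \<noteq> 0" using assms(1) that by auto
    then have "card Z \<le> card {z. poly q z = 0}"
      using that(2) by (intro card_mono poly_roots_finite) auto
    also have "\<dots> \<le> degree q" by (rule card_poly_roots_bound) fact
    also have "\<dots> < degree p"
      using \<open>q \<noteq> 0\<close> by (simp add: that(1) degree_mult_eq del: mult_pCons_left)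
    finally show ?thesis using assms(3) by simp
  qed
  from w obtain q where q: "p = [:-w, 1:] * q"
    by (metis poly_eq_0_iff_dvd dvd_def)
  have "w \<in> Z"
  proof (rule ccontr)
    assume "w \<notin> Z"
    then have "poly q z = 0" if "z \<in> Z" for z
      using Z[OF that] that by (auto simp: q)
    then show False using bound[OF q] by simp
  qed
  moreover have "order w p = 1"
  proof (rule ccontr)
    assume "order w p \<noteq> 1"
    moreover have "order w p \<noteq> 0" using w assms(1) by (simp add: order_root)
    ultimately have "[:-w, 1:] ^ 2 dvd p"
      by (intro order_divides[THEN iffD2]) simp
    then obtain s where "p = [:-w, 1:] ^ 2 * s" by auto
    then have s: "p = [:-w, 1:] * ([:-w, 1:] * s)" by (simp add: power2_eq_square mult.assoc del: mult_pCons_left)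
    have "poly ([:-w, 1:] * s) z = 0" if "z \<in> Z" for z
      using Z[OF that] by (auto simp: s)
    then show False using bound[OF s] by simp
  qed
  ultimately show ?thesis ..
qed

text \<open>Rolle between consecutive points. Differentiability is asked only in the open interval,
  because a power of \<open>- x\<close> need not be differentiable at the endpoint 0.\<close>

lemma Rolle_finite_set:
  fixes f f' :: "real \<Rightarrow> real"
  assumes "finite S" "S \<noteq> {}" "S \<subseteq> {l..u}"
    and cont: "continuous_on {l..u} f"
    and der: "\<And>x. l < x \<Longrightarrow> x < u \<Longrightarrow> (f has_real_derivative f' x) (at x)"
    and zero: "\<And>x. x \<in> S \<Longrightarrow> f x = 0"
  obtains Z where "finite Z" "Suc (card Z) = card S" "Z \<subseteq> {l<..<u}" "\<And>z. z \<in> Z \<Longrightarrow> f' z = 0"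
proof -
  \<comment> \<open>Keeping the zeros strictly between points of \<open>S\<close> ensures that a
    zero found beyond the previous maximum is new.\<close>
  have "\<exists>Z. finite Z \<and> Suc (card Z) = card S \<and> Z \<subseteq> {z. (\<exists>s\<in>S. s < z) \<and> (\<exists>s\<in>S. z < s)} \<and>
      (\<forall>z\<in>Z. f' z = 0)"
    using assms(1-3) zero
  proof (induction rule: finite_linorder_max_induct)
    case empty
    then show ?case by simp
  next
    case (insert b A)
    show ?case
    proof (cases "A = {}")
      case True
      then show ?thesis by (intro exI[of _ "{}"]) simp
    next
      case False
      with insert obtain Z where Z: "finite Z" "Suc (card Z) = card A"
        "Z \<subseteq> {z. (\<exists>s\<in>A. s < z) \<and> (\<exists>s\<in>A. z < s)}" "\<forall>z\<in>Z. f' z = 0"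
        by auto
      define a where "a = Max A"
      have a: "a \<in> A" "\<And>s. s \<in> A \<Longrightarrow> s \<le> a" using False insert.hyps by (auto simp: a_def)
      have ab: "a < b" using a insert.hyps by auto
      have bounds: "l \<le> a" "b \<le> u" using a insert.prems by auto
      have "\<exists>z>a. z < b \<and> f' z = 0"
      proof -
        have "continuous_on {a..b} f"
          using cont bounds by (auto intro: continuous_on_subset)
        moreover have "f differentiable (at x)" if "a < x" "x < b" for x
          using der[of x] that bounds by (auto simp: real_differentiable_def)
        ultimately obtain d z where z: "a < z" "z < b" "(f has_real_derivative d) (at z)"
            "f b - f a = (b - a) * d"
          using MVT[OF ab] by blast
        moreover have "d = f' z"
          using z bounds by (intro DERIV_unique[OF z(3)] der) auto
        ultimately show ?thesis using insert.prems a ab by auto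
      qed
      then obtain z where z: "a < z" "z < b" "f' z = 0" by auto
      have "z \<notin> Z" using Z(3) a(2) z(1) by force
      then show ?thesis
        using Z z a insert.hyps
        by (intro exI[of _ "insert z Z"]) auto
    qed
  qed
  then obtain Z where Z: "finite Z" "Suc (card Z) = card S"
    "Z \<subseteq> {z. (\<exists>s\<in>S. s < z) \<and> (\<exists>s\<in>S. z < s)}" "\<forall>z\<in>Z. f' z = 0" by auto
  show thesis
  proof (rule that[OF Z(1,2)])
    show "Z \<subseteq> {l<..<u}" using Z(3) assms(3) by fastforce
  qed (use Z in auto)
qed

lemma neg_roots_add_x_pderiv:
  fixes p :: "real poly"
  assumes "finite Z" "Z \<subseteq> {..<0}" "\<And>z. z \<in> Z \<Longrightarrow> poly p z = 0" "\<alpha> > 0" "\<beta> > 0"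
  obtains Z' where "finite Z'" "card Z' = card Z" "Z' \<subseteq> {..<0}"
    "\<And>z. z \<in> Z' \<Longrightarrow> \<alpha> * poly p z + \<beta> * z * poly (pderiv p) z = 0"
proof -
  define \<gamma> where "\<gamma> = \<alpha> / \<beta>"
  have \<gamma>: "\<gamma> > 0" using assms by (simp add: \<gamma>_def)
  \<comment> \<open>\<open>\<alpha> p + \<beta> x p'\<close> is, up to a nonzero factor on the negative axis, the derivative of
    \<open>(- x) powr (\<alpha> / \<beta>) * p x\<close>, which has the additional zero \<open>0\<close>.\<close>
  define f where "f x = (- x) powr \<gamma> * poly p x" for x
  define f' where "f' x = - ((- x) powr (\<gamma> - 1) * (\<gamma> * poly p x + x * poly (pderiv p) x))" for x
  define l where "l = Min (insert 0 Z)"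
  obtain Z' where Z': "finite Z'" "Suc (card Z') = card (insert 0 Z)" "Z' \<subseteq> {l<..<0}"
    "\<And>z. z \<in> Z' \<Longrightarrow> f' z = 0"
  proof (rule Rolle_finite_set[of "insert 0 Z" l 0 f f'])
    show "continuous_on {l..0} f"
      unfolding f_def by (intro continuous_intros continuous_on_powr') (use \<gamma> in auto)
    show "(f has_real_derivative f' x) (at x)" if "l < x" "x < 0" for x
    proof -
      have "(- x) powr \<gamma> = (- x) powr (\<gamma> - 1) * (- x)"
        using that by (simp add: powr_diff)
      moreover have "(f has_real_derivative
          - \<gamma> * (- x) powr (\<gamma> - 1) * poly p x + (- x) powr \<gamma> * poly (pderiv p) x) (at x)"
        unfolding f_def using that by (auto intro!: derivative_eq_intros simp: algebra_simps)
      ultimately show ?thesis by (simp add: f'_def algebra_simps)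
    qed
  qed (use assms in \<open>auto simp: l_def f_def\<close>)
  show thesis
  proof (rule that[OF Z'(1)])
    show "card Z' = card Z" using Z'(2) assms(1,2) by (auto simp: card_insert_if split: if_splits)
    show "Z' \<subseteq> {..<0}" using Z'(3) by auto
    show "\<alpha> * poly p z + \<beta> * z * poly (pderiv p) z = 0" if "z \<in> Z'" for z
    proof -
      have "\<gamma> * poly p z + z * poly (pderiv p) z = 0"
        using Z'(4)[OF that] Z'(3) that by (auto simp: f'_def)
      then have "\<beta> * (\<gamma> * poly p z + z * poly (pderiv p) z) = 0" by simp
      then show ?thesis using assms(5) by (simp add: \<gamma>_def algebra_simps)
    qed
  qed
qed

text \<open>Differentiate \<open>u ^ degree p * poly p (inverse u)\<close>, which agrees with the
  reversed polynomial in a neighbourhood of any nonzero \<open>u\<close>.\<close>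

lemma reflect_poly_x_pderiv:
  fixes p :: "real poly"
  assumes "u \<noteq> 0"
  shows "u * poly (pderiv (reflect_poly p)) u =
    u ^ degree p * (degree p * poly p (inverse u) - inverse u * poly (pderiv p) (inverse u))"
proof -
  have "((\<lambda>x. x ^ degree p * poly p (inverse x)) has_real_derivative
      u ^ degree p * (poly (pderiv p) (inverse u) * (- (inverse u * inverse u))) +
      real (degree p) * u ^ (degree p - 1) * poly p (inverse u)) (at u)"
    using assms by (auto intro!: derivative_eq_intros)
  moreover have "eventually (\<lambda>x. poly (reflect_poly p) x = x ^ degree p * poly p (inverse x)) (nhds u)"
    using assms by (auto intro!: eventually_mono[OF t1_space_nhds[of u 0]] poly_reflect_poly_nz)
  ultimately have "(poly (reflect_poly p) has_real_derivative
      u ^ degree p * (poly (pderiv p) (inverse u) * (- (inverse u * inverse u))) +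
      real (degree p) * u ^ (degree p - 1) * poly p (inverse u)) (at u)"
    by (subst DERIV_cong_ev[OF refl _ refl])
  then have eq: "poly (pderiv (reflect_poly p)) u = 
      u ^ degree p * (poly (pderiv p) (inverse u) * (- (inverse u * inverse u))) +
      real (degree p) * u ^ (degree p - 1) * poly p (inverse u)"
    using DERIV_unique poly_DERIV by blast
  show ?thesis
    unfolding eq using assms by (cases "degree p") (simp_all add: field_simps)
qed

text \<open>Reversing the coefficients turns $p - \delta x p'$ into
  $(1 - \delta \deg p) p^* + \delta x (p^*)'$, so that no zero can escape to $-\infty$.\<close>

lemma neg_roots_diff_x_pderiv:
  fixes p :: "real poly" and \<delta> :: real
  assumes "finite Z" "Z \<subseteq> {..<0}" "\<And>z. z \<in> Z \<Longrightarrow> poly p z = 0" "\<delta> > 0" "\<delta> * degree p \<le> 1"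
    and "Z \<noteq> {}"
  obtains Z' where "finite Z'" "card Z' = (if \<delta> * degree p < 1 then card Z else card Z - 1)" "Z' \<subseteq> {..<0}"
    "\<And>z. z \<in> Z' \<Longrightarrow> poly p z - \<delta> * z * poly (pderiv p) z = 0"
proof -
  let ?q = "reflect_poly p"
  let ?Y = "inverse ` Z"
  have Y: "finite ?Y" "?Y \<subseteq> {..<0}" "\<And>z. z \<in> ?Y \<Longrightarrow> poly ?q z = 0" "card ?Y = card Z"
    using assms(1,2,3) by (auto simp: poly_reflect_poly_nz card_image inj_on_def)
  have "\<exists>Y'. finite Y' \<and> card Y' = (if \<delta> * degree p < 1 then card Z else card Z - 1) \<and>
     Y' \<subseteq> {..<0} \<and> (\<forall>y\<in>Y'. (1 - \<delta> * degree p) * poly ?q y + \<delta> * y * poly (pderiv ?q) y = 0)"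
  proof (cases "\<delta> * degree p < 1")
    case True
    then obtain Y' where "finite Y'" "card Y' = card ?Y" "Y' \<subseteq> {..<0}"
      "\<And>y. y \<in> Y' \<Longrightarrow> (1 - \<delta> * degree p) * poly ?q y + \<delta> * y * poly (pderiv ?q) y = 0"
      using neg_roots_add_x_pderiv[OF Y(1-3), of "1 - \<delta> * degree p" \<delta>] assms(4) by auto
    then show ?thesis using True Y(4) by auto
  next
    case False
    then have eq: "\<delta> * degree p = 1" using assms(5) by simp
    \<comment> \<open>In this boundary case only the derivative of the reversed polynomial survives.
      Plain Rolle gives one zero fewer, which matches the cancellation of the leading coefficient of
      \<open>p - \<delta> x p'\<close>.\<close>
    obtain Y' where "finite Y'" "Suc (card Y') = card ?Y" "Y' \<subseteq> {Min ?Y<..<Max ?Y}"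
      "\<And>z. z \<in> Y' \<Longrightarrow> poly (pderiv ?q) z = 0"
    proof (rule Rolle_finite_set[of ?Y "Min ?Y" "Max ?Y" "poly ?q" "poly (pderiv ?q)"])
      show "continuous_on {Min (inverse ` Z)..Max (inverse ` Z)} (poly (reflect_poly p))"
        by (intro continuous_intros)
    qed (use Y assms(6) in \<open>auto intro: poly_DERIV\<close>)
    moreover have "Max ?Y < 0" using Y assms(6) by (subst Max_less_iff) auto
    ultimately show ?thesis using eq Y(4) by (intro exI[of _ Y']) force
  qed
  then obtain Y' where Y': "finite Y'" "card Y' = (if \<delta> * degree p < 1 then card Z else card Z - 1)"
     "Y' \<subseteq> {..<0}" "\<And>y. y\<in>Y' \<Longrightarrow> (1 - \<delta> * degree p) * poly ?q y + \<delta> * y * poly (pderiv ?q) y = 0"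
    by blast
  show thesis
  proof (rule that[of "inverse ` Y'"])
    show "card (inverse ` Y') = (if \<delta> * degree p < 1 then card Z else card Z - 1)"
      using Y'(2) by (simp add: card_image inj_on_def)
    fix z assume "z \<in> inverse ` Y'"
    then obtain y where y: "y \<in> Y'" "z = inverse y" "y \<noteq> 0" using Y'(3) by auto
    have "y ^ degree p * (poly p z - \<delta> * z * poly (pderiv p) z) =
        (1 - \<delta> * degree p) * poly ?q y + \<delta> * (y * poly (pderiv ?q) y)"
      unfolding reflect_poly_x_pderiv[OF y(3)] poly_reflect_poly_nz[OF y(3)] y(2)
      by (simp add: algebra_simps)
    also have "\<dots> = 0" using Y'(4)[OF y(1)] by (simp add: algebra_simps)
    finally show "poly p z - \<delta> * z * poly (pderiv p) z = 0" using y(3) by simp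
  qed (use Y' in auto)
qed

section \<open>A Rodrigues formula\<close>

text \<open>By the Leibniz rule this is $1/k!$ times the $k$-th derivative of $t^{m+1}(1+t)^n$.\<close>

definition rodrigues :: "nat \<Rightarrow> nat \<Rightarrow> nat \<Rightarrow> real \<Rightarrow> real" where
  "rodrigues m n k t = (\<Sum>j\<le>k. real ((m + 1 choose (k - j)) * (n choose j)) * t ^ (m + 1 - k + j) * (1 + t) ^ (n - j))"

text \<open>Differentiating summand \<open>j\<close> gives multiples of the summands
  \<open>j\<close> and \<open>Suc j\<close> of the next sum. After reindexing, the coefficients
  \<open>Suc k - j\<close> and \<open>j\<close> add up to \<open>Suc k\<close>, the ratio of the two
  factorial normalisations.\<close>

lemma rodrigues_deriv:
  assumes "k \<le> m" "k \<le> n"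
  shows "(rodrigues m n k has_real_derivative real (Suc k) * rodrigues m n (Suc k) t) (at t)"
proof -
  define w where "w j = real ((m + 1 choose (Suc k - j)) * (n choose j)) * t ^ (m - k + j) * (1 + t) ^ (n - j)" for j
  have "(rodrigues m n k has_real_derivative
     (\<Sum>j\<le>k. real (Suc k - j) * w j + real (Suc j) * w (Suc j))) (at t)"
    unfolding rodrigues_def
  proof (rule DERIV_sum)
    fix j assume "j \<in> {..k}"
    then have j: "j \<le> k" by simp
    have absorb: "real (N choose a) * real (N - a) = real (Suc a) * real (N choose Suc a)" for N a
      using binomial_absorb_comp[of N a] binomial_absorption[of a N]
      by (metis mult.commute of_nat_mult)
    have "m + 1 - k + j = m + 1 - (k - j)" "Suc (k - j) = Suc k - j" using assms j by auto
    then have b1: "real (m + 1 choose (k - j)) * real (m + 1 - k + j) =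
        real (Suc k - j) * real (m + 1 choose (Suc k - j))"
      using absorb[of "m + 1" "k - j"] by simp
    note b2 = absorb[of n j]
    have e: "m + 1 - k + j - 1 = m - k + j" "m + 1 - k + j = m - k + Suc j" "n - j - 1 = n - Suc j"
      using assms j by auto
    have "((\<lambda>t. real ((m + 1 choose (k - j)) * (n choose j)) * t ^ (m + 1 - k + j) * (1 + t) ^ (n - j)) has_real_derivative
       (real (m + 1 choose (k - j)) * real (m + 1 - k + j)) * real (n choose j) * t ^ (m + 1 - k + j - 1) * (1 + t) ^ (n - j) +
       (real (n choose j) * real (n - j)) * real (m + 1 choose (k - j)) * t ^ (m + 1 - k + j) * (1 + t) ^ (n - j - 1)) (at t)"
      by (auto intro!: derivative_eq_intros simp: algebra_simps)
    then show "((\<lambda>t. real ((m + 1 choose (k - j)) * (n choose j)) * t ^ (m + 1 - k + j) * (1 + t) ^ (n - j)) has_real_derivative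
       real (Suc k - j) * w j + real (Suc j) * w (Suc j)) (at t)"
      unfolding b1 b2 unfolding e(1,3) unfolding e(2) by (simp add: w_def algebra_simps)
  qed
  also have "(\<Sum>j\<le>k. real (Suc k - j) * w j + real (Suc j) * w (Suc j)) =
     (\<Sum>j\<le>Suc k. real (Suc k - j) * w j) + (\<Sum>j\<le>Suc k. real j * w j)"
    by (subst (2) sum.atMost_Suc_shift) (simp add: sum.distrib)
  also have "\<dots> = (\<Sum>j\<le>Suc k. real (Suc k) * w j)"
    unfolding sum.distrib[symmetric] by (rule sum.cong) (auto simp: of_nat_diff algebra_simps)
  also have "\<dots> = real (Suc k) * rodrigues m n (Suc k) t"
    by (simp add: rodrigues_def w_def sum_distrib_left mult.assoc del: sum.atMost_Suc)
  finally show ?thesis .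
qed

text \<open>Before each differentiation the function also vanishes at -1 and 0, as
  \<open>k < m \<le> n\<close> keeps all exponents positive. Rolle therefore gains one zero each
  time.\<close>

lemma rodrigues_roots:
  assumes "k \<le> m" "m \<le> n"
  shows "\<exists>Z. finite Z \<and> card Z = k \<and> Z \<subseteq> {-1<..<0} \<and> (\<forall>z\<in>Z. rodrigues m n k z = 0)"
  using assms(1)
proof (induction k)
  case 0
  then show ?case by (intro exI[of _ "{}"]) auto
next
  case (Suc k)
  then obtain Z where Z: "finite Z" "card Z = k" "Z \<subseteq> {-1<..<0}" "\<forall>z\<in>Z. rodrigues m n k z = 0"
    by auto
  have d: "(rodrigues m n k has_real_derivative real (Suc k) * rodrigues m n (Suc k) t) (at t)" for t
    using Suc.prems assms(2) by (intro rodrigues_deriv) auto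
  obtain Z' where Z': "finite Z'" "Suc (card Z') = card (insert (-1) (insert 0 Z))" "Z' \<subseteq> {-1<..<0}"
    "\<And>z. z \<in> Z' \<Longrightarrow> real (Suc k) * rodrigues m n (Suc k) z = 0"
  proof (rule Rolle_finite_set[of "insert (-1) (insert 0 Z)" "-1" 0 "rodrigues m n k"
      "\<lambda>t. real (Suc k) * rodrigues m n (Suc k) t"])
    show "continuous_on {-1..0} (rodrigues m n k)"
      using d by (meson DERIV_isCont continuous_at_imp_continuous_on)
    have "rodrigues m n k 0 = 0" "rodrigues m n k (-1) = 0"
      using Suc.prems assms(2) by (auto simp: rodrigues_def intro!: sum.neutral)
    then show "rodrigues m n k x = 0" if "x \<in> insert (-1) (insert 0 Z)" for x
      using that Z by auto
  qed (use Z d in auto)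
  have "card (insert (-1) (insert 0 Z)) = Suc (Suc k)"
    using Z by (subst card_insert_disjoint; force)+
  then show ?case using Z' by (intro exI[of _ Z']) auto
qed

section \<open>From real to complex zeros\<close>

lemma antichain_poly_of_real:
  "(antichain_poly Q :: complex poly) = map_poly of_real (antichain_poly Q :: real poly)"
  by (rule poly_eqI) (simp add: antichain_poly_def coeff_map_poly coeff_sum, intro sum.cong, auto)

text \<open>Distinct real zeros in number at least the degree leave no room for other complex zeros
  or for multiplicities.\<close>

lemma antichain_poly_neg_simple_roots:
  fixes z :: complex
  assumes p: "(antichain_poly Q :: real poly) = p" "p \<noteq> 0"
    and Z: "finite Z" "degree p \<le> card Z" "Z \<subseteq> {..<0}" "\<And>x. x \<in> Z \<Longrightarrow> poly p x = 0"
    and z: "poly (antichain_poly Q) z = 0"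
  shows "z \<in> \<real> \<and> Re z < 0 \<and> order z (antichain_poly Q) = 1"
proof -
  have q: "antichain_poly Q = map_poly complex_of_real p"
    by (simp add: antichain_poly_of_real p(1))
  have eval: "poly (map_poly complex_of_real r) (complex_of_real x) = complex_of_real (poly r x)" for r x
    by (induction r) (auto simp: map_poly_pCons)
  have "z \<in> complex_of_real ` Z \<and> order z (antichain_poly Q) = 1"
  proof (rule card_roots_ge_degree_imp_simple)
    show "antichain_poly Q \<noteq> (0 :: complex poly)"
      using p(2) by (simp add: q map_poly_eq_0_iff)
    show "degree (antichain_poly Q :: complex poly) \<le> card (complex_of_real ` Z)"
      using Z(2) by (simp add: q degree_map_poly card_image inj_on_def)
    show "poly (antichain_poly Q) w = 0" if "w \<in> complex_of_real ` Z" for w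
      using that Z(4) eval by (auto simp: q)
  qed (use Z(1) z in auto)
  then show ?thesis using Z(3) by auto
qed

section \<open>The polynomial T and its zeros\<close>

text \<open>For \<open>n = m + 1\<close> the coefficients are the Narayana numbers
  \<open>N(m + 1, j + 1)\<close>.\<close>

definition narayana_poly :: "nat \<Rightarrow> nat \<Rightarrow> real poly" where
  "narayana_poly m n = (\<Sum>j\<le>m. monom (real ((m choose j) * (n choose j)) / real (Suc j)) j)"

lemma coeff_narayana_poly: "coeff (narayana_poly m n) j = real ((m choose j) * (n choose j)) / real (Suc j)"
  by (auto simp: narayana_poly_def coeff_sum binomial_eq_0)

lemma degree_narayana_poly:
  assumes "m \<le> n"
  shows "degree (narayana_poly m n) = m"
proof (rule antisym)
  show "degree (narayana_poly m n) \<le> m"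
    by (rule degree_le) (simp add: coeff_narayana_poly binomial_eq_0)
  show "m \<le> degree (narayana_poly m n)"
    using assms by (intro le_degree) (simp add: coeff_narayana_poly)
qed

lemma narayana_poly_nonzero: "narayana_poly m n \<noteq> 0"
  using coeff_narayana_poly[of m n 0] by auto

text \<open>The substitution x = t / (1 + t) maps (-1, 0) into the negative axis. The exponent
  \<open>m + 1\<close> in the Rodrigues function yields the weight 1 / (j + 1), since
  \<open>m + 1 choose (m - j)\<close> is \<open>(m + 1) / (j + 1)\<close> times
  \<open>m choose j\<close>.\<close>

lemma rodrigues_eq_narayana_poly:
  assumes "m \<le> n" "-1 < t" "t < 0"
  shows "rodrigues m n m t = real (m + 1) * t * (1 + t) ^ n * poly (narayana_poly m n) (t / (1 + t))"
proof -
  have "real ((m + 1 choose (m - j)) * (n choose j)) * t ^ (m + 1 - m + j) * (1 + t) ^ (n - j) =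
      real (m + 1) * t * (1 + t) ^ n *
        (real ((m choose j) * (n choose j)) / real (Suc j) * (t / (1 + t)) ^ j)" if "j \<le> m" for j
  proof -
    have "m + 1 choose (m - j) = (m + 1 choose Suc j)"
      using that by (subst binomial_symmetric) (auto simp: Suc_diff_le)
    moreover have "real (Suc j) * real (m + 1 choose Suc j) = real (m + 1) * real (m choose j)"
      using binomial_absorption[of j "m + 1"] by (metis add_diff_cancel_right' of_nat_mult)
    then have "real (m + 1 choose Suc j) = real (m + 1) * real (m choose j) / real (Suc j)"
      by (simp add: field_simps del: binomial_Suc_Suc)
    moreover have "(1 + t) ^ (n - j) = (1 + t) ^ n / (1 + t) ^ j"
      using that assms by (intro power_diff) auto
    ultimately show ?thesis by (simp add: power_divide)
  qed
  then show ?thesis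
    by (simp add: rodrigues_def narayana_poly_def poly_sum poly_monom sum_distrib_left)
qed

lemma narayana_poly_roots:
  assumes "m \<le> n"
  obtains Z where "finite Z" "card Z = m" "Z \<subseteq> {..<0}" "\<And>z. z \<in> Z \<Longrightarrow> poly (narayana_poly m n) z = 0"
proof -
  obtain Y where Y: "finite Y" "card Y = m" "Y \<subseteq> {-1<..<0}" "\<forall>y\<in>Y. rodrigues m n m y = 0"
    using rodrigues_roots[of m m n] assms by auto
  show thesis
  proof (rule that[of "(\<lambda>t. t / (1 + t)) ` Y"])
    have "inj_on (\<lambda>t. t / (1 + t)) Y"
    proof (rule inj_onI)
      fix x y assume "x \<in> Y" "y \<in> Y" and eq: "x / (1 + x) = y / (1 + y)"
      then have "x > -1" "y > -1" using Y(3) by auto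
      then have "x * (1 + y) = y * (1 + x)" using eq by (simp add: frac_eq_eq)
      then show "x = y" by (simp add: algebra_simps)
    qed
    then show "card ((\<lambda>t. t / (1 + t)) ` Y) = m" using Y(2) by (simp add: card_image)
    show "(\<lambda>t. t / (1 + t)) ` Y \<subseteq> {..<0}"
      using Y(3) by (force simp: divide_less_0_iff)
    show "poly (narayana_poly m n) z = 0" if "z \<in> (\<lambda>t. t / (1 + t)) ` Y" for z
    proof -
      from that obtain y where "y \<in> Y" "z = y / (1 + y)" by blast
      then show ?thesis
        using rodrigues_eq_narayana_poly[OF assms, of y] Y(3,4) by force
    qed
  qed (use Y in auto)
qed

text \<open>The \<open>m\<close> known zeros exhaust the degree, so each has order 1 and the
  derivative has order 0 there. This later excludes a common zero of the two factors.\<close>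

lemma narayana_poly_simple:
  assumes "m \<le> n" "poly (narayana_poly m n) z = 0"
  shows "poly (pderiv (narayana_poly m n)) z \<noteq> 0"
proof
  assume "poly (pderiv (narayana_poly m n)) z = 0"
  moreover obtain Z where Z: "finite Z" "card Z = m" "\<And>z. z \<in> Z \<Longrightarrow> poly (narayana_poly m n) z = 0"
    using narayana_poly_roots[OF assms(1)] by metis
  have "z \<in> Z" and ord: "order z (narayana_poly m n) = 1"
    using card_roots_ge_degree_imp_simple[OF narayana_poly_nonzero Z(1) _ Z(3) assms(2)] degree_narayana_poly[OF assms(1)] Z(2)
    by simp_all
  then have "m \<noteq> 0" using Z(1,2) by (metis card_0_eq empty_iff)
  then have "pderiv (narayana_poly m n) \<noteq> 0"
    using degree_narayana_poly[OF assms(1)] by (simp add: pderiv_eq_0_iff)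
  ultimately have "order z (pderiv (narayana_poly m n)) \<noteq> 0"
    by (simp add: order_root)
  then show False
    using order_pderiv[OF narayana_poly_nonzero assms(2)] ord by simp
qed

section \<open>Factorization of the determinant\<close>

abbreviation x_pderiv_narayana :: "nat \<Rightarrow> nat \<Rightarrow> real poly" where
  "x_pderiv_narayana m n \<equiv> pCons 0 (pderiv (narayana_poly m n))"

lemma coeff_x_pderiv_narayana: "coeff (x_pderiv_narayana m n) j = real j * coeff (narayana_poly m n) j"
  by (cases j) (simp_all add: coeff_pderiv)

text \<open>The operator 1 + x d/dx multiplies coefficient \<open>j\<close> by \<open>j + 1\<close>,
  cancelling the denominator.\<close>

lemma binom_poly_eq_narayana_add: "binom_poly m 0 n 0 = narayana_poly m n + x_pderiv_narayana m n"
proof (rule poly_eqI)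
  fix j
  have "coeff (narayana_poly m n) j * real (Suc j) = real ((m choose j) * (n choose j))"
    unfolding coeff_narayana_poly by simp
  then show "coeff (binom_poly m 0 n 0) j = coeff (narayana_poly m n + x_pderiv_narayana m n) j"
    unfolding coeff_add coeff_x_pderiv_narayana coeff_binom_poly by (simp add: algebra_simps)
qed

text \<open>Absorption in both binomials: for \<open>j \<ge> 1\<close>,
  \<open>(m + 1 choose j + 1) * (n - 1 choose j - 1)\<close> equals
  \<open>(m + 1) / n * j / (j + 1)\<close> times \<open>(m choose j) * (n choose j)\<close>.\<close>

lemma lgv_factor1:
  assumes "1 \<le> n"
  shows "monom 1 1 * binom_poly (Suc m) 2 (n - 1) 0 = smult (real (m + 1) / real n) (x_pderiv_narayana m n)"
proof (rule poly_eqI)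
  fix j
  show "coeff (monom 1 1 * binom_poly (Suc m) 2 (n - 1) 0) j = coeff (smult (real (m + 1) / real n) (x_pderiv_narayana m n)) j"
  proof (cases j)
    case 0
    then show ?thesis by (simp add: coeff_monom_1_1_mult del: One_nat_def)
  next
    case (Suc i)
    have "real (Suc (Suc i)) * real (Suc m choose Suc (Suc i)) = real (Suc m) * real (m choose Suc i)"
      by (metis binomial_absorption diff_Suc_1 of_nat_mult)
    then have 1: "real (Suc m choose Suc (Suc i)) = real (Suc m) * real (m choose Suc i) / real (Suc (Suc i))"
      by (simp add: field_simps del: binomial_Suc_Suc)
    have "real (Suc i) * real (n choose Suc i) = real n * real (n - 1 choose i)"
      by (metis binomial_absorption of_nat_mult)
    then have 2: "real (n - 1 choose i) = real (Suc i) * real (n choose Suc i) / real n"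
      using assms by (simp add: field_simps)
    show ?thesis
      unfolding Suc coeff_smult coeff_x_pderiv_narayana coeff_narayana_poly coeff_monom_1_1_mult
      by (simp add: coeff_binom_poly 1 2[unfolded One_nat_def] mult_ac del: binomial_Suc_Suc of_nat_Suc)
  qed
qed

text \<open>The previous identity with \<open>m\<close> and \<open>n\<close> exchanged; x T' is
  symmetric in them.\<close>

lemma lgv_factor2:
  assumes "1 \<le> m"
  shows "monom 1 1 * binom_poly (m - 1) 0 (Suc n) 2 = smult (real (n + 1) / real m) (x_pderiv_narayana m n)"
proof -
  have "monom 1 1 * binom_poly (m - 1) 0 (Suc n) 2 = monom 1 1 * (binom_poly (Suc n) 2 (m - 1) 0 :: real poly)"
    by (intro arg_cong2[where f="(*)"] poly_eqI) (auto simp: coeff_binom_poly)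
  moreover have "x_pderiv_narayana n m = x_pderiv_narayana m n"
    by (rule poly_eqI, unfold coeff_x_pderiv_narayana) (simp add: coeff_narayana_poly)
  ultimately show ?thesis using lgv_factor1[OF assms, of n] by simp
qed

lemma lgv_poly_factorization:
  assumes "1 \<le> m" "1 \<le> n" "c\<^sup>2 = real (m + 1) * real (n + 1) / (real m * real n)"
  shows "lgv_poly m n n = (narayana_poly m n + smult (1 + c) (x_pderiv_narayana m n)) * (narayana_poly m n - smult (c - 1) (x_pderiv_narayana m n))"
proof -
  define S T where "S = x_pderiv_narayana m n" and "T = narayana_poly m n"
  have "lgv_poly m n n = (T + S) * (T + S) - smult (real (m + 1) / real n * (real (n + 1) / real m)) (S * S)"
    unfolding lgv_poly_def lgv_factor1[OF assms(2)] lgv_factor2[OF assms(1)] binom_poly_eq_narayana_add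
      S_def[symmetric]
    unfolding T_def[symmetric]
    by (simp add: mult.commute)
  also have "real (m + 1) / real n * (real (n + 1) / real m) = c * c"
    using assms(3) by (simp add: power2_eq_square mult.commute)
  also have "(T + S) * (T + S) - smult (c * c) (S * S) = (T + smult (1 + c) S) * (T - smult (c - 1) S)"
    by (simp add: algebra_simps smult_add_left smult_diff_left smult_add_right)
  finally show ?thesis by (simp add: S_def T_def)
qed

section \<open>Zeros of the two factors\<close>

text \<open>The factor \<open>1 *\<close> matches the shape of \<open>neg_roots_add_x_pderiv\<close>
  with \<alpha> = 1.\<close>

lemma poly_narayana_add: "poly (narayana_poly m n + smult a (x_pderiv_narayana m n)) z =
    1 * poly (narayana_poly m n) z + a * z * poly (pderiv (narayana_poly m n)) z"
  by simp

lemma narayana_add_roots: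
  assumes "m \<le> n" "0 < a"
  obtains Z where "finite Z" "card Z = m" "Z \<subseteq> {..<0}"
    "\<And>z. z \<in> Z \<Longrightarrow> poly (narayana_poly m n + smult a (x_pderiv_narayana m n)) z = 0"
proof -
  obtain Z where "finite Z" "card Z = m" "Z \<subseteq> {..<0}" "\<And>z. z \<in> Z \<Longrightarrow> poly (narayana_poly m n) z = 0"
    using narayana_poly_roots[OF assms(1)] by metis
  then obtain Z' where "finite Z'" "card Z' = m" "Z' \<subseteq> {..<0}"
    "\<And>z. z \<in> Z' \<Longrightarrow> 1 * poly (narayana_poly m n) z + a * z * poly (pderiv (narayana_poly m n)) z = 0"
    using neg_roots_add_x_pderiv[of Z "narayana_poly m n" 1 a] assms(2) by auto
  then show thesis by (intro that) (simp_all only: poly_narayana_add)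
qed

lemma degree_narayana_add: "degree (narayana_poly m n + smult a (x_pderiv_narayana m n)) \<le> m"
  by (rule degree_le) (unfold coeff_add coeff_smult coeff_x_pderiv_narayana, simp add: coeff_narayana_poly binomial_eq_0)

lemma narayana_add_nonzero: "narayana_poly m n + smult a (x_pderiv_narayana m n) \<noteq> 0"
proof
  assume "narayana_poly m n + smult a (x_pderiv_narayana m n) = 0"
  then have "coeff (narayana_poly m n + smult a (x_pderiv_narayana m n)) 0 = 0" by simp
  then show False by (simp add: coeff_narayana_poly)
qed

lemma lgv_poly_roots:
  assumes "1 \<le> m" "m \<le> n"
  shows "\<exists>Z. finite Z \<and> degree (lgv_poly m n n :: real poly) \<le> card Z \<and> Z \<subseteq> {..<0} \<and>
    (\<forall>z\<in>Z. poly (lgv_poly m n n) z = (0::real))"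
    and "lgv_poly m n n \<noteq> (0 :: real poly)"
proof -
  let ?T = "narayana_poly m n" and ?S = "x_pderiv_narayana m n"
  define c where "c = sqrt (real (m + 1) * real (n + 1) / (real m * real n))"
  have c2: "c\<^sup>2 = real (m + 1) * real (n + 1) / (real m * real n)"
    by (simp add: c_def)
  have "c > 1"
    unfolding c_def using assms by (simp add: field_simps)
  \<comment> \<open>This is where \<open>m \<le> n\<close> enters. It gives
    \<open>(c - 1) * m \<le> 1\<close>, the condition for the zeros of the second factor to stay
    negative, with equality for \<open>m = n\<close>.\<close>
  have "c \<le> real (m + 1) / real m"
  proof -
    have "real (m + 1) * real (n + 1) / (real m * real n) \<le> (real (m + 1) / real m)\<^sup>2"
    proof -
      have "real (n + 1) / real n \<le> real (m + 1) / real m"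
        using assms by (simp add: field_simps)
      then have "real (m + 1) / real m * (real (n + 1) / real n) \<le> real (m + 1) / real m * (real (m + 1) / real m)"
        by (intro mult_left_mono) auto
      then show ?thesis by (simp add: power2_eq_square)
    qed
    then show ?thesis unfolding c_def by (intro real_le_lsqrt) auto
  qed
  then have \<delta>: "(c - 1) * real m \<le> 1" using assms by (simp add: field_simps)
  define N1 N2 where "N1 = ?T + smult (1 + c) ?S" and "N2 = ?T - smult (c - 1) ?S"
  have N: "lgv_poly m n n = N1 * N2"
    unfolding N1_def N2_def by (rule lgv_poly_factorization) (use assms c2 in auto)
  \<comment> \<open>In this form the degree bound and the nonvanishing for an arbitrary real
    coefficient also cover the negative \<open>1 - c\<close>.\<close>
  have N2_alt: "N2 = ?T + smult (1 - c) ?S"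
    by (simp add: N2_def smult_diff_left)
  have nz: "N1 \<noteq> 0" "N2 \<noteq> 0"
    by (simp_all only: N1_def N2_alt narayana_add_nonzero not_False_eq_True)
  then show "lgv_poly m n n \<noteq> (0 :: real poly)" by (simp add: N)
  obtain Z1 where Z1: "finite Z1" "card Z1 = m" "Z1 \<subseteq> {..<0}" "\<And>z. z \<in> Z1 \<Longrightarrow> poly N1 z = 0"
    using narayana_add_roots[OF assms(2), of "1 + c"] \<open>c > 1\<close> unfolding N1_def by auto
  obtain Z where Z: "finite Z" "card Z = m" "Z \<subseteq> {..<0}" "\<And>z. z \<in> Z \<Longrightarrow> poly ?T z = 0"
    using narayana_poly_roots[OF assms(2)] by metis
  obtain Z2 where Z2: "finite Z2" "card Z2 = (if (c - 1) * real m < 1 then m else m - 1)"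
    "Z2 \<subseteq> {..<0}" "\<And>z. z \<in> Z2 \<Longrightarrow> poly N2 z = 0"
  proof -
    have "Z \<noteq> {}" using Z(2) assms(1) by auto
    then obtain Y where Y: "finite Y" "card Y = (if (c - 1) * real m < 1 then m else m - 1)"
      "Y \<subseteq> {..<0}" "\<And>z. z \<in> Y \<Longrightarrow> poly ?T z - (c - 1) * z * poly (pderiv ?T) z = 0"
      using neg_roots_diff_x_pderiv[OF Z(1,3,4), of "c - 1"] \<open>c > 1\<close> \<delta>
      unfolding degree_narayana_poly[OF assms(2)] Z(2) by (metis diff_gt_0_iff_gt)
    have "poly N2 z = 0" if "z \<in> Y" for z
      using Y(4)[OF that] by (simp add: N2_def)
    with Y(1-3) show ?thesis by (rule that)
  qed
  have "degree N2 \<le> card Z2"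
  proof (cases "(c - 1) * real m < 1")
    case True
    then show ?thesis using degree_narayana_add[of m n "1 - c"] by (simp add: N2_alt Z2(2))
  next
    case False
    then have "(c - 1) * real m = 1" using \<delta> by simp
    then have top: "(1 - c) * real m = -1" by (simp add: algebra_simps)
    \<comment> \<open>The top coefficient of \<open>N2\<close> is \<open>1 + (1 - c) * m = 0\<close>
      times that of T, so the degree drops along with the number of zeros found.\<close>
    have "coeff N2 j = 0" if "j > m - 1" for j
    proof (cases "j = m")
      case True
      have "coeff N2 m = coeff ?T m + (1 - c) * real m * coeff ?T m"
        unfolding N2_alt coeff_add coeff_smult coeff_x_pderiv_narayana by simp
      then show ?thesis by (simp add: True top)
    next
      case False
      then have "j > degree N2"
        using that degree_narayana_add[of m n "1 - c"] by (simp add: N2_alt)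
      then show ?thesis by (rule coeff_eq_0)
    qed
    then show ?thesis using False by (simp add: Z2(2) degree_le)
  qed
  moreover have "degree N1 \<le> card Z1"
    using degree_narayana_add by (simp add: N1_def Z1(2))
  moreover have "Z1 \<inter> Z2 = {}"
  proof (rule ccontr)
    assume "Z1 \<inter> Z2 \<noteq> {}"
    then obtain z where z: "z \<in> Z1" "z \<in> Z2" by auto
    define w where "w = z * poly (pderiv ?T) z"
    have 1: "poly ?T z + (1 + c) * w = 0"
      using Z1(4)[OF z(1)] by (simp add: N1_def w_def mult.left_commute)
    have 2: "poly ?T z - (c - 1) * w = 0"
      using Z2(4)[OF z(2)] by (simp add: N2_def w_def mult.left_commute)
    have "2 * c * w = (poly ?T z + (1 + c) * w) - (poly ?T z - (c - 1) * w)"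
      by (simp add: algebra_simps)
    then have "w = 0" unfolding 1 2 using \<open>c > 1\<close> by simp
    moreover have "z \<noteq> 0" using z(1) Z1(3) by auto
    ultimately have "poly (pderiv ?T) z = 0" "poly ?T z = 0" using 1 by (auto simp: w_def)
    then show False using narayana_poly_simple[OF assms(2)] by simp
  qed
  ultimately have "degree (lgv_poly m n n :: real poly) \<le> card (Z1 \<union> Z2)"
    using Z1(1) Z2(1) nz by (simp add: N degree_mult_eq card_Un_disjoint)
  then show "\<exists>Z. finite Z \<and> degree (lgv_poly m n n :: real poly) \<le> card Z \<and> Z \<subseteq> {..<0} \<and>
    (\<forall>z\<in>Z. poly (lgv_poly m n n) z = (0::real))"
    using Z1 Z2 by (intro exI[of _ "Z1 \<union> Z2"]) (auto simp: N)
qed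

section \<open>The cases k = 1 and k = 2\<close>

text \<open>With level 2 empty the second product vanishes, because \<open>1 choose (j + 2)\<close>
  is 0.\<close>

lemma lgv_poly_0: "lgv_poly i u 0 = binom_poly i 0 u 0"
proof -
  have "binom_poly i 0 0 0 = (1 :: 'a::comm_ring_1 poly)"
    by (rule poly_eqI) (auto simp: coeff_binom_poly binomial_eq_0)
  then show ?thesis by (simp add: lgv_poly_def binom_poly_eq_0)
qed

theorem theorem3p18:
  fixes k m n :: nat and z :: complex
  assumes "1 \<le> k" and "k \<le> 2" and "k \<le> m" and "m \<le> n"
    and "poly (antichain_poly (chain_set k \<times> chain_set m \<times> chain_set n)) z = 0"
  shows "z \<in> \<real> \<and> Re z < 0 \<and>
    order z (antichain_poly (chain_set k \<times> chain_set m \<times> chain_set n)) = 1"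
proof (cases "k = 1")
  case True
  \<comment> \<open>A single level is the two-level poset whose level 2 has no columns.\<close>
  have "chain_set k \<times> chain_set m \<times> chain_set n = region m 0 n 0 0"
    by (auto simp: chain_set_def region_def True)
  then have p: "(antichain_poly (chain_set k \<times> chain_set m \<times> chain_set n) :: real poly) =
      narayana_poly m n + smult 1 (x_pderiv_narayana m n)"
    by (simp add: antichain_poly_region[of 0 n 0 m m] lgv_poly_0 binom_poly_eq_narayana_add)
  obtain Z where Z: "finite Z" "card Z = m" "Z \<subseteq> {..<0}"
    "\<And>z. z \<in> Z \<Longrightarrow> poly (narayana_poly m n + smult 1 (x_pderiv_narayana m n)) z = 0"
    using narayana_add_roots[OF assms(4), of 1] by auto
  show ?thesis
    by (rule antichain_poly_neg_simple_roots[OF p narayana_add_nonzero Z(1) _ Z(3,4) assms(5)])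
      (simp_all only: degree_narayana_add Z(2))
next
  case False
  then have k: "k = 2" using assms by simp
  have "chain_set k \<times> chain_set m \<times> chain_set n = region m 0 n 0 n"
    by (auto simp: chain_set_def region_def k)
  then have p: "(antichain_poly (chain_set k \<times> chain_set m \<times> chain_set n) :: real poly) = lgv_poly m n n"
    by (simp add: antichain_poly_region[of n n 0 m m])
  obtain Z where Z: "finite Z" "degree (lgv_poly m n n :: real poly) \<le> card Z" "Z \<subseteq> {..<0}"
    "\<And>x. x \<in> Z \<Longrightarrow> poly (lgv_poly m n n) x = (0::real)"
    using lgv_poly_roots(1)[of m n] assms by auto
  have "lgv_poly m n n \<noteq> (0 :: real poly)"
    using lgv_poly_roots(2)[of m n] assms by auto
  then show ?thesis
    by (rule antichain_poly_neg_simple_roots[OF p _ Z assms(5)])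
qed

end
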